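(* There exists a number $N$ such that for every language $L\subseteq\{0,1\}^*$, every integer $n>N$, every $\epsilon>0$, and every $s\le \mathcal{C}_L(n)\,\epsilon^2/(3n)$, there exists a multiset of $s/\epsilon^2$ binary strings of length $n$ such that every circuit of size $s$ misclassifies (with respect to membership in $L$) at least a fraction $1/2-\epsilon$ of the strings in the multiset.
   Context: The size of a circuit is the length of its encoding in binary. $\mathcal{C}_L(n)$, the circuit complexity of $L$, is the size of the smallest circuit that correctly decides membership in $L$ for all $n$-bit binary strings. A circuit misclassifies a string $x$ if its output differs from the indicator of $x\in L$. *)

theory Defs
  imports Complex_Main "HOL-Library.Multiset"
begin

text \<open>
  A circuit is a straight-line program of gates over the basis AND, OR, NOT with fan-in at most
  two; the last gate is the output and gates may be reused arbitrarily often. Predecessors are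
  addressed relatively: the argument \<open>0\<close> is the gate immediately before the current one,
  \<open>1\<close> the one before that, and so on. Hence placing circuits one after another does not
  lengthen their codes, as it would with absolute gate numbers.
\<close>

datatype gate =
    Input_gate nat
  | Const_gate bool
  | Not_gate nat
  | And_gate nat nat
  | Or_gate nat nat

datatype circuit = Circuit (arity: nat) (gates: "gate list")

fun gate_ok :: "nat \<Rightarrow> nat \<Rightarrow> gate \<Rightarrow> bool" where
  "gate_ok n p (Input_gate i) \<longleftrightarrow> i < n"
| "gate_ok n p (Const_gate b) \<longleftrightarrow> True"
| "gate_ok n p (Not_gate i) \<longleftrightarrow> i < p"
| "gate_ok n p (And_gate i j) \<longleftrightarrow> i < p \<and> j < p"
| "gate_ok n p (Or_gate i j) \<longleftrightarrow> i < p \<and> j < p"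

definition well_formed :: "circuit \<Rightarrow> bool" where
  "well_formed c \<longleftrightarrow> gates c \<noteq> [] \<and>
     (\<forall>p < length (gates c). gate_ok (arity c) p (gates c ! p))"

definition circuits :: "nat \<Rightarrow> circuit set" where
  "circuits n = {c. well_formed c \<and> arity c = n}"

fun gate_value :: "bool list \<Rightarrow> bool list \<Rightarrow> gate \<Rightarrow> bool" where
  "gate_value x vs (Input_gate i) = x ! i"
| "gate_value x vs (Const_gate b) = b"
| "gate_value x vs (Not_gate i) = (\<not> vs ! i)"
| "gate_value x vs (And_gate i j) = (vs ! i \<and> vs ! j)"
| "gate_value x vs (Or_gate i j) = (vs ! i \<or> vs ! j)"

text \<open>The list of gate values computed so far is kept with the most recent value first.\<close>

fun run_gates :: "bool list \<Rightarrow> gate list \<Rightarrow> bool list \<Rightarrow> bool list" where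
  "run_gates x [] vs = vs"
| "run_gates x (g # gs) vs = run_gates x gs (gate_value x vs g # vs)"

definition circuit_output :: "circuit \<Rightarrow> bool list \<Rightarrow> bool" where
  "circuit_output c x = hd (run_gates x (gates c) [])"

text \<open>
  Self-delimiting code for numbers: the binary digits, least significant first, each preceded by
  the continuation bit \<open>True\<close>, and a final \<open>False\<close>.
\<close>

fun encode_nat :: "nat \<Rightarrow> bool list" where
  "encode_nat k = (if k = 0 then [False] else True # odd k # encode_nat (k div 2))"

declare encode_nat.simps [simp del]

fun encode_gate :: "gate \<Rightarrow> bool list" where
  "encode_gate (Const_gate b) = [False, False, b]"
| "encode_gate (Not_gate i) = [False, True, False] @ encode_nat i"
| "encode_gate (Input_gate i) = [False, True, True] @ encode_nat i"
| "encode_gate (And_gate i j) = [True, False] @ encode_nat i @ encode_nat j"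
| "encode_gate (Or_gate i j) = [True, True] @ encode_nat i @ encode_nat j"

definition encode_circuit :: "circuit \<Rightarrow> bool list" where
  "encode_circuit c = encode_nat (arity c) @ concat (map encode_gate (gates c))"

definition circuit_size :: "circuit \<Rightarrow> nat" where
  "circuit_size c = length (encode_circuit c)"

definition misclassifies :: "circuit \<Rightarrow> bool list set \<Rightarrow> bool list \<Rightarrow> bool" where
  "misclassifies c L x \<longleftrightarrow> circuit_output c x \<noteq> (x \<in> L)"

definition decides :: "circuit \<Rightarrow> bool list set \<Rightarrow> nat \<Rightarrow> bool" where
  "decides c L n \<longleftrightarrow> (\<forall>x. length x = n \<longrightarrow> \<not> misclassifies c L x)"

definition circuit_complexity :: "bool list set \<Rightarrow> nat \<Rightarrow> nat" where
  "circuit_complexity L n = (LEAST s. \<exists>c \<in> circuits n. decides c L n \<and> circuit_size c = s)"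


text \<open>The encoding is uniquely decodable.\<close>

lemma encode_nat_prefix_free:
  "encode_nat i @ u = encode_nat j @ v \<Longrightarrow> i = j \<and> u = v"
proof (induction i arbitrary: j rule: less_induct)
  case (less i)
  show ?case
  proof (cases "i = 0 \<or> j = 0")
    case True
    then show ?thesis
      using less.prems by (auto simp: encode_nat.simps[of i] encode_nat.simps[of j] split: if_splits)
  next
    case False
    then have *: "odd i = odd j" "encode_nat (i div 2) @ u = encode_nat (j div 2) @ v"
      using less.prems by (auto simp: encode_nat.simps[of i] encode_nat.simps[of j])
    have "i div 2 = j div 2 \<and> u = v"
      using less.IH[OF _ *(2)] False by simp
    moreover have "i mod 2 = j mod 2"
      using *(1) by presburger
    ultimately show ?thesis
      by (metis div_mod_decomp)
  qed
qed

lemma encode_gate_prefix_free: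
  "encode_gate g @ u = encode_gate h @ v \<Longrightarrow> g = h \<and> u = v"
  by (cases g; cases h) (auto dest!: encode_nat_prefix_free)

lemma encode_gate_nonempty: "encode_gate g \<noteq> []"
  by (cases g) auto

lemma encode_gates_inject:
  "concat (map encode_gate gs) = concat (map encode_gate hs) \<Longrightarrow> gs = hs"
proof (induction gs arbitrary: hs)
  case Nil
  then show ?case by (cases hs) (auto simp: encode_gate_nonempty)
next
  case (Cons g gs)
  then show ?case
    by (cases hs) (auto simp: encode_gate_nonempty dest!: encode_gate_prefix_free)
qed

lemma inj_encode_circuit: "inj encode_circuit"
proof (rule injI)
  fix c d assume "encode_circuit c = encode_circuit d"
  then show "c = d"
    unfolding encode_circuit_def
    by (cases c; cases d) (auto dest!: encode_nat_prefix_free encode_gates_inject)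
qed


text \<open>Every language is decided by some circuit at every length, so the minimum defining
  \<open>circuit_complexity\<close> is attained.\<close>

lemma run_gates_append: "run_gates x (gs @ hs) vs = run_gates x hs (run_gates x gs vs)"
  by (induction gs arbitrary: vs) auto

lemma gate_ok_mono: "gate_ok n p g \<Longrightarrow> p \<le> q \<Longrightarrow> gate_ok n q g"
  by (cases g) auto

lemma exists_gates:
  assumes "j \<le> n"
  shows "\<exists>gs. gs \<noteq> [] \<and> (\<forall>p < length gs. gate_ok n p (gs ! p)) \<and>
           (\<forall>x vs. length x = n \<longrightarrow>
             (\<exists>ws. run_gates x gs vs = f (take j x) # ws @ vs \<and> Suc (length ws) = length gs))"
  using assms
proof (induction j arbitrary: f)
  case 0
  show ?case by (rule exI[of _ "[Const_gate (f [])]"]) auto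
next
  case (Suc j)
  from Suc.IH[of "\<lambda>y. f (y @ [False])"] Suc.prems obtain p where
    p: "\<forall>i < length p. gate_ok n i (p ! i)"
      "\<And>x vs. length x = n \<Longrightarrow> \<exists>ws. run_gates x p vs = f (take j x @ [False]) # ws @ vs
        \<and> Suc (length ws) = length p"
    by auto
  from Suc.IH[of "\<lambda>y. f (y @ [True])"] Suc.prems obtain q where
    q: "\<forall>i < length q. gate_ok n i (q ! i)"
      "\<And>x vs. length x = n \<Longrightarrow> \<exists>ws. run_gates x q vs = f (take j x @ [True]) # ws @ vs
        \<and> Suc (length ws) = length q" "q \<noteq> []" 
    by auto
  have p0: "p \<noteq> []"
    using p(2)[of "replicate n False" "[]"] by auto
  define r where "r = [Input_gate j, And_gate 0 1, Not_gate 1, And_gate 0 (3 + length q), Or_gate 0 2]"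
  define gs where "gs = p @ q @ r"
  have ok: "gate_ok n i (gs ! i)" if i: "i < length gs" for i
  proof -
    consider "i < length p" | "length p \<le> i" "i < length p + length q"
      | m where "i = length p + length q + m" "m < 5"
    proof -
      assume cases: "i < length p \<Longrightarrow> thesis"
        "length p \<le> i \<Longrightarrow> i < length p + length q \<Longrightarrow> thesis"
        "\<And>m. i = length p + length q + m \<Longrightarrow> m < 5 \<Longrightarrow> thesis"
      show thesis
        using cases(1,2) cases(3)[of "i - (length p + length q)"] i
        by (simp add: gs_def r_def) linarith
    qed
    then show ?thesis
    proof cases
      case 1
      then show ?thesis using p(1) by (simp add: gs_def nth_append)
    next
      case 2
      then show ?thesis
        using q(1) gate_ok_mono[of n "i - length p" _ i] by (simp add: gs_def nth_append)
    next
      case (3 m)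
      then have "m \<in> {0, 1, 2, 3, 4}" by auto
      moreover have "gs ! i = r ! m"
        using 3 by (simp add: gs_def nth_append)
      ultimately show ?thesis
        using 3 p0 q(3) Suc.prems by (auto simp: r_def Suc_le_eq)
    qed
  qed
  have val: "\<exists>ws. run_gates x gs vs = f (take (Suc j) x) # ws @ vs \<and> Suc (length ws) = length gs"
    if x: "length x = n" for x vs
  proof -
    obtain ws where ws: "run_gates x p vs = f (take j x @ [False]) # ws @ vs"
      "Suc (length ws) = length p"
      using p(2)[OF x] by blast
    obtain us where us: "run_gates x q (run_gates x p vs) =
        f (take j x @ [True]) # us @ run_gates x p vs" "Suc (length us) = length q"
      using q(2)[OF x] by blast
    have t: "take (Suc j) x = take j x @ [x ! j]"
      using x Suc.prems by (simp add: take_Suc_conv_app_nth)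
    have pq: "run_gates x (p @ q) vs =
        f (take j x @ [True]) # us @ f (take j x @ [False]) # ws @ vs"
      using ws(1) us(1) by (simp add: run_gates_append)
    have "run_gates x gs vs = run_gates x r (run_gates x (p @ q) vs)"
      by (simp add: gs_def run_gates_append)
    also have "\<dots> = f (take (Suc j) x) #
        ([\<not> x ! j \<and> f (take j x @ [False]), \<not> x ! j, x ! j \<and> f (take j x @ [True]), x ! j,
          f (take j x @ [True])] @ us @ f (take j x @ [False]) # ws) @ vs"
      unfolding pq t r_def us(2)[symmetric]
      by (cases "x ! j") (simp_all add: nth_append numeral_eq_Suc)
    finally have *: "run_gates x gs vs = f (take (Suc j) x) #
        ([\<not> x ! j \<and> f (take j x @ [False]), \<not> x ! j, x ! j \<and> f (take j x @ [True]), x ! j,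
          f (take j x @ [True])] @ us @ f (take j x @ [False]) # ws) @ vs"
      (is "_ = _ # ?us @ vs") .
    have "Suc (length ?us) = length gs"
      using ws(2) us(2) by (simp add: gs_def r_def)
    with * show ?thesis by blast
  qed
  show ?case
    using ok val q(3) by (intro exI[of _ gs]) (auto simp: gs_def)
qed

lemma exists_deciding_circuit: "\<exists>c \<in> circuits n. decides c L n"
proof -
  obtain gs where gs: "gs \<noteq> []" "\<forall>p < length gs. gate_ok n p (gs ! p)"
    "\<And>x vs. length x = n \<Longrightarrow> \<exists>ws. run_gates x gs vs = (take n x \<in> L) # ws @ vs"
    using exists_gates[of n n "\<lambda>y. y \<in> L"] by blast
  have "decides (Circuit n gs) L n"
    using gs(3)[of _ "[]"] by (fastforce simp: decides_def misclassifies_def circuit_output_def)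
  moreover have "Circuit n gs \<in> circuits n"
    using gs by (simp add: circuits_def well_formed_def)
  ultimately show ?thesis by blast
qed

lemma circuit_complexity_attained:
  "\<exists>c \<in> circuits n. decides c L n \<and> circuit_size c = circuit_complexity L n"
  unfolding circuit_complexity_def by (rule LeastI_ex) (use exists_deciding_circuit in blast)

end

theory Submission
  imports Defs "HOL-Probability.Hoeffding" "HOL-Real_Asymp.Real_Asymp"
begin

text \<open>
  Circuits of size at most \<open>s\<close> play against inputs of length \<open>n\<close>, the payoff being
  misclassification. Either every weighting of the inputs admits a circuit of error at most
  \<open>1/2 - 2\<epsilon>/5\<close>, or some weighting makes every circuit err with weight more than that. Both
  alternatives are turned into a short list of pure strategies by multiplicative weights, with the
  constant of Hoeffding's lemma.

  In the first case about \<open>2.18 n / \<epsilon>\<^sup>2\<close> circuits have a majority vote that is correct on all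
  \<open>2^n\<close> inputs. A balanced tree of ripple-carry adders computes the vote with \<open>O(log s)\<close> extra bits
  per circuit, because a node of height \<open>d\<close> costs \<open>O(d (d + log s))\<close> bits and there are
  geometrically few of them. The total stays below \<open>3 n s / \<epsilon>\<^sup>2\<close>, which contradicts the
  assumption on the circuit complexity. In the second case averaging shows that every weighting of
  the circuits admits an input on which they do badly, and \<open>s / \<epsilon>\<^sup>2\<close> such inputs defeat all of the
  fewer than \<open>2^s\<close> circuits. The constants fit since \<open>2 (3/5)\<^sup>2 > ln 2\<close> and
  \<open>2.18 \<cdot> 2 (2/5)\<^sup>2 > ln 2\<close>.
\<close>

subsection \<open>Multiplicative weights\<close>

text \<open>The potential of \<open>b\<close> is \<open>exp (h * excess)\<close>, where the excess
  is the number of hits on \<open>b\<close> minus its target \<open>v\<close> per round. Answering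
  the current potentials multiplies their sum by at most \<open>exp (h\<^sup>2 / 8)\<close>. A
  single \<open>b\<close> with excess \<open>k * t\<close> would already exceed the final
  sum.\<close>

lemma multiplicative_weights:
  fixes M :: "'a \<Rightarrow> 'b \<Rightarrow> bool" and v t :: real
  assumes B: "finite B" and v: "v \<ge> 0" and t: "t \<ge> 0"
    and response: "\<And>w. (\<And>b. b \<in> B \<Longrightarrow> w b > 0) \<Longrightarrow>
      \<exists>a\<in>A. (\<Sum>b\<in>B. w b * of_bool (M a b)) \<le> v * (\<Sum>b\<in>B. w b)"
    and card: "real (card B) < exp (2 * real k * t\<^sup>2)"
  shows "\<exists>as. length as = k \<and> set as \<subseteq> A \<and>
    (\<forall>b\<in>B. real (length (filter (\<lambda>a. M a b) as)) < real k * (v + t))"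
proof -
  \<comment> \<open>This \<open>h\<close> maximises \<open>h * t - h\<^sup>2 / 8\<close>; the
    maximum \<open>2 * t\<^sup>2\<close> is the exponent per round in \<open>card\<close>.\<close>
  define h where "h = 4 * t"
  have h: "h \<ge> 0" using t by (simp add: h_def)
  define W where "W as b = exp (h * (real (length (filter (\<lambda>a. M a b) as)) - real (length as) * v))"
    for as b
  \<comment> \<open>As \<open>M\<close> is 0/1-valued, \<open>exp (h * M)\<close> equals
    \<open>1 + (exp h - 1) * M\<close> exactly, so the new sum is linear in the weighted loss that
    \<open>response\<close> controls.\<close>
  have W_Cons: "W (a # as) b = exp (- h * v) * (W as b + (exp h - 1) * (W as b * of_bool (M a b)))"
    for a as b
    by (auto simp: W_def algebra_simps simp flip: exp_add)
  have hoeffding: "exp (- h * v) * (1 + v * (exp h - 1)) \<le> exp (h\<^sup>2 / 8)"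
  proof -
    have pos: "1 + v * (exp h - 1) > 0"
      using v h by (intro add_pos_nonneg mult_nonneg_nonneg) auto
    have "- h * v + ln (1 + v * (exp h - 1)) \<le> h\<^sup>2 / 8"
      by (rule Hoeffdings_lemma_aux[OF h v])
    then have "exp (- h * v + ln (1 + v * (exp h - 1))) \<le> exp (h\<^sup>2 / 8)"
      by simp
    then show ?thesis
      using pos by (simp only: exp_add exp_ln)
  qed
  have "\<exists>as. length as = j \<and> set as \<subseteq> A \<and>
      (\<Sum>b\<in>B. W as b) \<le> real (card B) * exp (h\<^sup>2 / 8) ^ j" for j
  proof (induction j)
    case 0
    show ?case by (rule exI[of _ "[]"]) (simp add: W_def)
  next
    case (Suc j)
    then obtain as where as: "length as = j" "set as \<subseteq> A"
      "(\<Sum>b\<in>B. W as b) \<le> real (card B) * exp (h\<^sup>2 / 8) ^ j"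
      by blast
    obtain a where a: "a \<in> A"
      "(\<Sum>b\<in>B. W as b * of_bool (M a b)) \<le> v * (\<Sum>b\<in>B. W as b)"
      using response[of "W as"] by (auto simp: W_def)
    have "(\<Sum>b\<in>B. W (a # as) b) = exp (- h * v) *
        ((\<Sum>b\<in>B. W as b) + (exp h - 1) * (\<Sum>b\<in>B. W as b * of_bool (M a b)))"
      by (simp only: W_Cons sum_distrib_left[symmetric] sum.distrib)
    also have "\<dots> \<le> exp (- h * v) *
        ((\<Sum>b\<in>B. W as b) + (exp h - 1) * (v * (\<Sum>b\<in>B. W as b)))"
      using a(2) h by (intro mult_left_mono add_left_mono) auto
    also have "\<dots> = (exp (- h * v) * (1 + v * (exp h - 1))) * (\<Sum>b\<in>B. W as b)"
      by (simp add: algebra_simps)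
    also have "\<dots> \<le> exp (h\<^sup>2 / 8) * (real (card B) * exp (h\<^sup>2 / 8) ^ j)"
      using hoeffding as(3) by (intro mult_mono) (auto simp: W_def intro: sum_nonneg)
    finally show ?case
      using as a(1) by (intro exI[of _ "a # as"]) (simp add: algebra_simps)
  qed
  then obtain as where as: "length as = k" "set as \<subseteq> A"
    "(\<Sum>b\<in>B. W as b) \<le> real (card B) * exp (h\<^sup>2 / 8) ^ k"
    by blast
  have "real (length (filter (\<lambda>a. M a b) as)) < real k * (v + t)" if b: "b \<in> B" for b
  proof -
    have "W as b \<le> (\<Sum>b\<in>B. W as b)"
      using b B by (intro member_le_sum) (auto simp: W_def)
    also have "\<dots> \<le> real (card B) * exp (h\<^sup>2 / 8) ^ k"
      by (rule as(3))
    also have "\<dots> < exp (2 * real k * t\<^sup>2) * exp (h\<^sup>2 / 8) ^ k"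
      using card by (intro mult_strict_right_mono) auto
    also have "\<dots> = exp (h * (real k * t))"
      by (simp add: h_def power2_eq_square algebra_simps flip: exp_of_nat_mult exp_add)
    finally have "h * (real (length (filter (\<lambda>a. M a b) as)) - real k * v) < h * (real k * t)"
      by (simp add: W_def as(1))
    then have "real (length (filter (\<lambda>a. M a b) as)) - real k * v < real k * t"
      using h by (rule mult_left_less_imp_less)
    then show ?thesis by (simp add: algebra_simps)
  qed
  with as show ?thesis by blast
qed

subsection \<open>Code lengths\<close>

lemma length_encode_nat_le: "i < 2 ^ e \<Longrightarrow> length (encode_nat i) \<le> 2 * e + 1"
proof (induction e arbitrary: i)
  case 0
  then show ?case by (simp add: encode_nat.simps)
next
  case (Suc e)
  then show ?case using Suc.IH[of "i div 2"] by (subst encode_nat.simps) auto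
qed

text \<open>The code of a circuit contains its arity, so this forces every circuit on many inputs to
  be large.\<close>

lemma length_encode_nat_ge: "2 ^ e \<le> i \<Longrightarrow> e < length (encode_nat i)"
proof (induction e arbitrary: i)
  case 0
  then show ?case by (subst encode_nat.simps) auto
next
  case (Suc e)
  then have "2 ^ e \<le> i div 2" "i \<noteq> 0"
    by (auto simp: less_eq_div_iff_mult_less_eq intro!: Nat.gr0I)
  then show ?case using Suc.IH[of "i div 2"] by (subst encode_nat.simps) auto
qed

abbreviation gates_bits :: "gate list \<Rightarrow> nat" where
  "gates_bits gs \<equiv> length (concat (map encode_gate gs))"

lemma circuit_size_eq: "circuit_size c = length (encode_nat (arity c)) + gates_bits (gates c)"
  by (simp add: circuit_size_def encode_circuit_def)

lemma length_le_gates_bits: "length gs \<le> gates_bits gs"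
proof (induction gs)
  case (Cons g gs)
  then show ?case using encode_gate_nonempty[of g] by (cases "encode_gate g") auto
qed simp

text \<open>For fixed arity the gate codes alone determine the circuit. The arity code takes at
  least one of the \<open>s\<close> bits, so at most \<open>2 ^ s - 1\<close> strings remain; the
  strict bound is what \<open>multiplicative_weights\<close> asks for.\<close>

lemma circuits_bounded_size:
  shows finite_circuits_bounded_size: "finite {c \<in> circuits n. circuit_size c \<le> s}"
    and card_circuits_bounded_size: "card {c \<in> circuits n. circuit_size c \<le> s} < 2 ^ s"
proof -
  let ?C = "{c \<in> circuits n. circuit_size c \<le> s}"
  let ?f = "\<lambda>c. concat (map encode_gate (gates c))"
  let ?T = "{bs :: bool list. set bs \<subseteq> UNIV \<and> length bs \<le> s - 1}"
  have pos: "length (encode_nat n) \<ge> 1"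
    by (subst encode_nat.simps) auto
  have inj: "inj_on ?f ?C"
    by (rule inj_onI) (auto simp: circuits_def intro: circuit.expand dest!: encode_gates_inject)
  have sub: "?f ` ?C \<subseteq> ?T"
    using pos by (auto simp: circuits_def circuit_size_eq)
  have finT: "finite ?T" by (rule finite_lists_length_le) simp
  show "finite ?C"
    using finite_subset[OF sub finT] inj by (simp add: finite_image_iff)
  show "card ?C < 2 ^ s"
  proof (cases "s = 0")
    case True
    then have "?C = {}" using pos by (auto simp: circuits_def circuit_size_eq)
    then show ?thesis by (simp only:) simp
  next
    case False
    have "card ?C \<le> card ?T"
      using card_inj_on_le[OF inj sub finT] .
    also have "\<dots> = (\<Sum>i\<le>s - 1. 2 ^ i)"
      by (subst card_lists_length_le) auto
    also have "\<dots> = 2 ^ s - 1"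
      using False sum_power2[of s] by (cases s) (auto simp: lessThan_Suc_atMost atLeast0LessThan)
    finally have "card ?C \<le> 2 ^ s - 1" .
    moreover have "(0::nat) < 2 ^ s" by simp
    ultimately show ?thesis by linarith
  qed
qed

subsection \<open>Counting circuits\<close>

text \<open>Here \<open>q\<close> values are already on the stack, which makes well-formedness split
  over append.\<close>

primrec ok_gates :: "nat \<Rightarrow> nat \<Rightarrow> gate list \<Rightarrow> bool" where
  "ok_gates n q [] \<longleftrightarrow> True"
| "ok_gates n q (g # gs) \<longleftrightarrow> gate_ok n q g \<and> ok_gates n (Suc q) gs"

lemma ok_gates_iff: "ok_gates n q gs \<longleftrightarrow> (\<forall>p < length gs. gate_ok n (q + p) (gs ! p))"
  by (induction gs arbitrary: q) (auto simp: All_less_Suc2)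

lemma ok_gates_append [simp]:
  "ok_gates n q (gs @ hs) \<longleftrightarrow> ok_gates n q gs \<and> ok_gates n (q + length gs) hs"
  by (induction gs arbitrary: q) auto

lemma ok_gates_mono: "ok_gates n q gs \<Longrightarrow> q \<le> q' \<Longrightarrow> ok_gates n q' gs"
  by (auto simp: ok_gates_iff intro: gate_ok_mono)

lemma well_formed_iff: "well_formed c \<longleftrightarrow> gates c \<noteq> [] \<and> ok_gates (arity c) 0 (gates c)"
  by (simp add: well_formed_def ok_gates_iff)

lemma length_run_gates [simp]: "length (run_gates x gs vs) = length gs + length vs"
  by (induction gs arbitrary: vs) auto

text \<open>No address reaches below \<open>us\<close>. With relative addressing, a closed block can
  thus be placed on any stack without changing its code.\<close>

lemma run_gates_local:
  "ok_gates n (length us) gs \<Longrightarrow> run_gates x gs (us @ vs) = run_gates x gs us @ vs"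
proof (induction gs arbitrary: us)
  case (Cons g gs)
  have "gate_value x (us @ vs) g = gate_value x us g"
    using Cons.prems by (cases g) (auto simp: nth_append)
  with Cons show ?case by (simp flip: append_Cons)
qed simp

lemma run_gates_closed: "ok_gates n 0 gs \<Longrightarrow> run_gates x gs vs = run_gates x gs [] @ vs"
  using run_gates_local[of n "[]" gs x vs] by (simp only: append_Nil list.size)

section \<open>Ripple-carry addition by straight-line programs\<close>

fun bits_value :: "bool list \<Rightarrow> nat" where
  "bits_value [] = 0"
| "bits_value (b # bs) = of_bool b + 2 * bits_value bs"

lemma bits_value_append: "bits_value (bs @ cs) = bits_value bs + 2 ^ length bs * bits_value cs"
  by (induction bs) (auto simp: algebra_simps)

lemma bits_value_less: "bits_value bs < 2 ^ length bs"
  by (induction bs) auto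

text \<open>The incoming carry is on top of the stack and is reached as 4 and 5 after the first
  exclusive or. Each exclusive or is the OR conjoined with the negated AND, and the two ANDs are
  reused for the outgoing carry. That carry ends at address 0 and the sum bit at address 1, so
  adders chain.\<close>

definition full_adder :: "nat \<Rightarrow> nat \<Rightarrow> gate list" where
  "full_adder a b =
    [And_gate a b, Or_gate (a + 1) (b + 1), Not_gate 1, And_gate 1 0,
     And_gate 0 4, Or_gate 1 5, Not_gate 1, And_gate 1 0, Or_gate 7 3]"

text \<open>
  The carry is on top of the stack; \<open>q\<close> counts the values pushed since the state that the
  addresses in the list refer to.
\<close>

fun ripple_adder :: "nat \<Rightarrow> (nat \<times> nat) list \<Rightarrow> gate list" where
  "ripple_adder q [] = []"
| "ripple_adder q ((a, b) # ps) = full_adder (a + q) (b + q) @ ripple_adder (q + 9) ps"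

text \<open>
  Stack addresses, least significant bit first, of the sum bits after a ripple-carry addition of
  \<open>d\<close>-bit numbers; address 0 is the final carry. They depend only on \<open>d\<close>, so the nodes
  of an adder tree need no copying gates.
\<close>

fun sum_positions :: "nat \<Rightarrow> nat list" where
  "sum_positions 0 = [0]"
| "sum_positions (Suc d) = (9 * d + 1) # sum_positions d"

lemma length_sum_positions [simp]: "length (sum_positions d) = Suc d"
  by (induction d) auto

lemma sum_positions_le: "p \<in> set (sum_positions d) \<Longrightarrow> p \<le> 9 * d"
  by (induction d) auto

lemma sum_positions_Suc: "\<exists>ps. sum_positions (Suc d) = ps @ [1, 0] \<and> length ps = d"
proof (induction d)
  case (Suc d)
  then obtain ps where "sum_positions (Suc d) = ps @ [1, 0]" "length ps = d" by blast
  then show ?case by (intro exI[of _ "(9 * Suc d + 1) # ps"]) simp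
qed simp

lemma length_full_adder [simp]: "length (full_adder a b) = 9"
  by (simp add: full_adder_def)

lemma length_ripple_adder [simp]: "length (ripple_adder q ps) = 9 * length ps"
  by (induction q ps rule: ripple_adder.induct) auto

lemma ok_ripple_adder:
  assumes "\<And>a b. (a, b) \<in> set ps \<Longrightarrow> a < m \<and> b < m" and "q > 0"
  shows "ok_gates n (m + q) (ripple_adder q ps)"
  using assms
proof (induction q ps rule: ripple_adder.induct)
  case (2 q a b ps)
  have "ok_gates n (m + (q + 9)) (ripple_adder (q + 9) ps)"
    using 2 by (intro "2.IH") auto
  moreover have "ok_gates n (m + q) (full_adder (a + q) (b + q))"
    using 2 by (auto simp: full_adder_def)
  ultimately show ?case by (simp add: add_ac)
qed simp

lemma run_full_adder:
  assumes "a < length vs" "b < length vs" "vs \<noteq> []"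
  shows "\<exists>us. run_gates x (full_adder a b) vs = us @ vs \<and> length us = 9 \<and>
    of_bool (us ! 1) + 2 * of_bool (hd us) = of_bool (vs ! a) + of_bool (vs ! b) + (of_bool (hd vs) :: nat)"
proof -
  obtain c ws where vs: "vs = c # ws" using assms(3) by (cases vs) auto
  obtain p q where pq: "(c # ws) ! a = p" "(c # ws) ! b = q" by blast
  define y where "y \<longleftrightarrow> (p \<or> q) \<and> \<not> (p \<and> q)"
  let ?us = "[p \<and> q \<or> y \<and> c, (y \<or> c) \<and> \<not> (y \<and> c), \<not> (y \<and> c), y \<or> c, y \<and> c, y,
    \<not> (p \<and> q), p \<or> q, p \<and> q]"
  have "run_gates x (full_adder a b) vs = ?us @ vs"
    unfolding full_adder_def y_def vs using pq
    by (cases p; cases q; cases c) (simp_all add: numeral_eq_Suc)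
  moreover have "of_bool (?us ! 1) + 2 * of_bool (hd ?us) =
      of_bool p + of_bool q + (of_bool (hd vs) :: nat)"
    by (simp add: y_def vs)
  ultimately show ?thesis
    by (intro exI[of _ ?us]) (simp add: pq vs)
qed

text \<open>The invariant is that \<open>us\<close>, the values pushed above the operands
  \<open>ws\<close>, has the incoming carry on top. The sum is read from \<open>rs @ us\<close>
  because for empty \<open>ps\<close> its only bit is that carry.\<close>

lemma run_ripple_adder:
  assumes "\<And>a b. (a, b) \<in> set ps \<Longrightarrow> a < length ws \<and> b < length ws"
    and "length us = q" "us \<noteq> []"
  shows "\<exists>rs. run_gates x (ripple_adder q ps) (us @ ws) = rs @ us @ ws \<and>
    length rs = 9 * length ps \<and>
    bits_value (map ((!) (rs @ us)) (sum_positions (length ps))) =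
      bits_value (map (\<lambda>p. ws ! fst p) ps) + bits_value (map (\<lambda>p. ws ! snd p) ps) + of_bool (hd us)"
  using assms
proof (induction q ps arbitrary: us rule: ripple_adder.induct)
  case (1 q)
  then show ?case by (auto simp: hd_conv_nth)
next
  case (2 q a b ps)
  obtain ts where ts: "run_gates x (full_adder (a + q) (b + q)) (us @ ws) = ts @ us @ ws"
    "length ts = 9" "of_bool (ts ! 1) + 2 * of_bool (hd ts) =
      of_bool (ws ! a) + of_bool (ws ! b) + (of_bool (hd us) :: nat)"
    using run_full_adder[of "a + q" "us @ ws" "b + q" x] 2(2-) by (fastforce simp: nth_append)
  obtain rs where rs: "run_gates x (ripple_adder (q + 9) ps) ((ts @ us) @ ws) = rs @ (ts @ us) @ ws"
    "length rs = 9 * length ps"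
    "bits_value (map ((!) (rs @ ts @ us)) (sum_positions (length ps))) =
      bits_value (map (\<lambda>p. ws ! fst p) ps) + bits_value (map (\<lambda>p. ws ! snd p) ps)
        + of_bool (hd (ts @ us))"
    using "2.IH"[of "ts @ us"] 2(2-) ts(2) by auto
  have "hd (ts @ us) = hd ts" using ts(2) by (cases ts) auto
  moreover have "(rs @ ts @ us) ! (9 * length ps + 1) = ts ! 1"
    using rs(2) ts(2) by (simp add: nth_append)
  ultimately show ?case
    using ts rs by (intro exI[of _ "rs @ ts"]) (simp add: run_gates_append)
qed

section \<open>Balanced trees of adders\<close>

fun adder_tree :: "nat \<Rightarrow> gate list list \<Rightarrow> gate list" where
  "adder_tree 0 gss = hd gss"
| "adder_tree (Suc d) gss =
    (let l = adder_tree d (take (2 ^ d) gss); r = adder_tree d (drop (2 ^ d) gss) in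
     l @ r @ Const_gate False #
       ripple_adder 1 (zip (map ((+) (length r)) (sum_positions d)) (sum_positions d)))"

declare adder_tree.simps(2) [simp del]

definition output_count :: "bool list \<Rightarrow> gate list list \<Rightarrow> nat" where
  "output_count x gss = (\<Sum>gs\<leftarrow>gss. of_bool (hd (run_gates x gs [])))"

lemma output_count_append [simp]: "output_count x (gss @ hss) = output_count x gss + output_count x hss"
  by (simp add: output_count_def)

text \<open>The bound \<open>9 * d < length\<close> keeps all addresses in
  \<open>sum_positions d\<close> within the tree's own values, so that the parent can read the
  counts of both subtrees.\<close>

lemma adder_tree_correct:
  assumes "length gss = 2 ^ d" and "\<And>gs. gs \<in> set gss \<Longrightarrow> gs \<noteq> [] \<and> ok_gates n 0 gs"
  shows "ok_gates n 0 (adder_tree d gss) \<and> 9 * d < length (adder_tree d gss) \<and>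
    bits_value (map ((!) (run_gates x (adder_tree d gss) [])) (sum_positions d)) = output_count x gss"
  using assms
proof (induction d arbitrary: gss)
  case 0
  then obtain gs where gss: "gss = [gs]" by (cases gss) auto
  then have "gs \<noteq> []" "ok_gates n 0 gs" using 0 by auto
  moreover from \<open>gs \<noteq> []\<close> have "run_gates x gs [] \<noteq> []"
    by (metis add_is_0 length_0_conv length_run_gates)
  ultimately show ?case
    by (simp add: gss output_count_def hd_conv_nth)
next
  case (Suc d)
  define l where "l = adder_tree d (take (2 ^ d) gss)"
  define r where "r = adder_tree d (drop (2 ^ d) gss)"
  define ps where "ps = zip (map ((+) (length r)) (sum_positions d)) (sum_positions d)"
  define lv where "lv = run_gates x l []"
  define rv where "rv = run_gates x r []"
  have l: "ok_gates n 0 l" "9 * d < length l"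
    "bits_value (map ((!) lv) (sum_positions d)) = output_count x (take (2 ^ d) gss)"
    using Suc.IH[of "take (2 ^ d) gss"] Suc.prems by (auto simp: l_def lv_def dest: in_set_takeD)
  have r: "ok_gates n 0 r" "9 * d < length r"
    "bits_value (map ((!) rv) (sum_positions d)) = output_count x (drop (2 ^ d) gss)"
    using Suc.IH[of "drop (2 ^ d) gss"] Suc.prems by (auto simp: r_def rv_def dest: in_set_dropD)
  have len: "length lv = length l" "length rv = length r" by (simp_all add: lv_def rv_def)
  have tree: "adder_tree (Suc d) gss = l @ r @ Const_gate False # ripple_adder 1 ps"
    by (simp add: adder_tree.simps Let_def l_def r_def ps_def)
  have ps: "a < length l + length r \<and> b < length l + length r" if "(a, b) \<in> set ps" for a b
    using that l(2) r(2) set_zip_leftD[OF that[unfolded ps_def]] set_zip_rightD[OF that[unfolded ps_def]]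
    by (auto dest!: sum_positions_le)
  have ok: "ok_gates n 0 (adder_tree (Suc d) gss)"
    using l(1) r(1) ok_ripple_adder[of ps "length l + length r" 1 n] ps
    by (auto simp: tree intro: ok_gates_mono)
  have run: "run_gates x (adder_tree (Suc d) gss) [] =
      run_gates x (ripple_adder 1 ps) ([False] @ rv @ lv)"
    using run_gates_closed[OF r(1), of x lv] by (simp add: tree run_gates_append lv_def rv_def)
  have lps: "length ps = Suc d" by (simp add: ps_def)
  obtain rs where rs: "run_gates x (ripple_adder 1 ps) ([False] @ rv @ lv) = rs @ [False] @ rv @ lv"
    "length rs = 9 * Suc d"
    "bits_value (map ((!) (rs @ [False])) (sum_positions (Suc d))) =
      bits_value (map (\<lambda>p. (rv @ lv) ! fst p) ps) + bits_value (map (\<lambda>p. (rv @ lv) ! snd p) ps)"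
    using run_ripple_adder[of ps "rv @ lv" "[False]" 1 x] ps len lps by (auto simp: add_ac)
  \<comment> \<open>The values of \<open>r\<close> lie above those of \<open>l\<close>; the shift by
    \<open>length r\<close> in \<open>ps\<close> skips them.\<close>
  have fst: "map (\<lambda>p. (rv @ lv) ! fst p) ps = map ((!) lv) (sum_positions d)"
  proof -
    have "map (\<lambda>p. (rv @ lv) ! fst p) ps = map ((!) (rv @ lv)) (map fst ps)" by simp
    also have "map fst ps = map ((+) (length r)) (sum_positions d)" by (simp add: ps_def)
    finally show ?thesis by (simp add: nth_append len)
  qed
  have snd: "map (\<lambda>p. (rv @ lv) ! snd p) ps = map ((!) rv) (sum_positions d)"
  proof -
    have "map (\<lambda>p. (rv @ lv) ! snd p) ps = map ((!) (rv @ lv)) (map snd ps)" by simp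
    also have "map snd ps = sum_positions d" by (simp add: ps_def)
    finally show ?thesis using r(2) by (auto simp: nth_append len dest: sum_positions_le)
  qed
  have "map ((!) (rs @ [False] @ rv @ lv)) (sum_positions (Suc d)) =
      map ((!) (rs @ [False])) (sum_positions (Suc d))"
    using sum_positions_le[of _ "Suc d"] rs(2)
    by (intro map_cong refl) (fastforce simp: nth_append)
  then have "bits_value (map ((!) (run_gates x (adder_tree (Suc d) gss) [])) (sum_positions (Suc d)))
      = output_count x (take (2 ^ d) gss) + output_count x (drop (2 ^ d) gss)"
    using rs l(3) r(3) by (simp only: run fst snd)
  also have "\<dots> = output_count x gss"
    by (simp flip: output_count_append)
  finally show ?case
    using ok lps by (simp add: tree)
qed

section \<open>Code length of adder trees\<close>

lemma gates_bits_le: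
  assumes "ok_gates n q gs" "\<And>i. Input_gate i \<notin> set gs" "q + length gs \<le> 2 ^ e"
  shows "gates_bits gs \<le> length gs * (4 * e + 4)"
  using assms
proof (induction gs arbitrary: q)
  case (Cons g gs)
  have q: "q < 2 ^ e" using Cons.prems(3) by simp
  have enc: "length (encode_nat i) \<le> 2 * e + 1" if "i < q" for i
    using length_encode_nat_le[of i e] that q by simp
  \<comment> \<open>The worst case is a binary gate: two tag bits and two addresses of
    \<open>2 * e + 1\<close> bits. Input gates are excluded because their index is not bounded by
    the stack height.\<close>
  have "length (encode_gate g) \<le> 4 * e + 4"
    using Cons.prems(1,2) by (cases g) (auto dest!: enc)
  moreover have "gates_bits gs \<le> length gs * (4 * e + 4)"
    using Cons.prems by (intro Cons.IH[of "Suc q"]) auto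
  ultimately show ?case by simp
qed simp

lemma Input_gate_notin_ripple_adder: "Input_gate i \<notin> set (ripple_adder q ps)"
  by (induction q ps rule: ripple_adder.induct) (auto simp: full_adder_def)

text \<open>A node adds \<open>9 * d + 10\<close> gates, and
  \<open>2 * (9 * d + 19) = (9 * d + 10) + (9 * Suc d + 19)\<close>, so the extra summand makes the
  bound double exactly.\<close>

lemma length_adder_tree_le:
  assumes "length gss = 2 ^ d" and "\<And>gs. gs \<in> set gss \<Longrightarrow> length gs \<le> m"
  shows "length (adder_tree d gss) + 9 * d + 19 \<le> 2 ^ d * (m + 19)"
  using assms
proof (induction d arbitrary: gss)
  case 0
  then show ?case by (cases gss) auto
next
  case (Suc d)
  define B where "B = 2 ^ d * (m + 19)"
  have "length (adder_tree d (take (2 ^ d) gss)) + 9 * d + 19 \<le> B"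
    unfolding B_def using Suc.prems by (intro Suc.IH) (auto dest: in_set_takeD)
  moreover have "length (adder_tree d (drop (2 ^ d) gss)) + 9 * d + 19 \<le> B"
    unfolding B_def using Suc.prems by (intro Suc.IH) (auto dest: in_set_dropD)
  moreover have "2 ^ Suc d * (m + 19) = 2 * B"
    by (simp add: B_def)
  moreover have "length (adder_tree (Suc d) gss) = length (adder_tree d (take (2 ^ d) gss)) +
      length (adder_tree d (drop (2 ^ d) gss)) + 9 * d + 10"
    by (simp add: adder_tree.simps Let_def)
  ultimately show ?case by simp
qed

text \<open>
  The quadratic term on the left is the one that makes the recursion
  \<open>X (d + 1) = 2 X d + (9 (d + 1) + 1) (4 (d + 1 + r) + 4)\<close> for the overhead \<open>X d\<close> telescope.
\<close>

lemma adder_tree_bits_le: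
  assumes "length gss = 2 ^ d"
    and "\<And>gs. gs \<in> set gss \<Longrightarrow> gs \<noteq> [] \<and> ok_gates n 0 gs \<and> length gs \<le> m"
    and "m + 19 \<le> 2 ^ r"
  shows "gates_bits (adder_tree d gss) + (36 * d\<^sup>2 + (36 * (r + 1) + 148) * d + 76 * (r + 1) + 224)
    \<le> (\<Sum>gs\<leftarrow>gss. gates_bits gs) + 2 ^ d * (76 * (r + 1) + 224)"
  using assms
proof (induction d arbitrary: gss)
  case 0
  then show ?case by (cases gss) auto
next
  case (Suc d)
  define l where "l = adder_tree d (take (2 ^ d) gss)"
  define r' where "r' = adder_tree d (drop (2 ^ d) gss)"
  define hs where "hs = Const_gate False #
    ripple_adder 1 (zip (map ((+) (length r')) (sum_positions d)) (sum_positions d))"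
  have tree: "adder_tree (Suc d) gss = (l @ r') @ hs"
    by (simp add: adder_tree.simps Let_def l_def r'_def hs_def)
  have l: "gates_bits l + (36 * d\<^sup>2 + (36 * (r + 1) + 148) * d + 76 * (r + 1) + 224)
      \<le> (\<Sum>gs\<leftarrow>take (2 ^ d) gss. gates_bits gs) + 2 ^ d * (76 * (r + 1) + 224)"
    unfolding l_def using Suc.prems by (intro Suc.IH) (auto dest: in_set_takeD)
  have r: "gates_bits r' + (36 * d\<^sup>2 + (36 * (r + 1) + 148) * d + 76 * (r + 1) + 224)
      \<le> (\<Sum>gs\<leftarrow>drop (2 ^ d) gss. gates_bits gs) + 2 ^ d * (76 * (r + 1) + 224)"
    unfolding r'_def using Suc.prems by (intro Suc.IH) (auto dest: in_set_dropD)
  have sum: "(\<Sum>gs\<leftarrow>gss. gates_bits gs) =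
      (\<Sum>gs\<leftarrow>take (2 ^ d) gss. gates_bits gs) + (\<Sum>gs\<leftarrow>drop (2 ^ d) gss. gates_bits gs)"
    by (metis append_take_drop_id map_append sum_list_append)
  have ok: "ok_gates n 0 ((l @ r') @ hs)"
    using adder_tree_correct[of gss "Suc d" n] Suc.prems by (simp add: tree)
  \<comment> \<open>The length of the whole tree bounds every address in the root adder, hence
    \<open>Suc d + r\<close> bits suffice for each.\<close>
  have "length ((l @ r') @ hs) \<le> 2 ^ Suc d * (m + 19)"
    using length_adder_tree_le[of gss "Suc d" m] Suc.prems unfolding tree by simp
  also have "\<dots> \<le> 2 ^ Suc d * 2 ^ r"
    using Suc.prems(3) by (rule mult_left_mono) simp
  finally have "length (l @ r') + length hs \<le> 2 ^ (Suc d + r)"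
    by (simp add: power_add)
  then have "gates_bits hs \<le> length hs * (4 * (Suc d + r) + 4)"
    using ok Input_gate_notin_ripple_adder
    by (intro gates_bits_le[of n "length (l @ r')"]) (auto simp: hs_def)
  moreover have "length hs = 9 * Suc d + 1"
    by (simp add: hs_def)
  ultimately have hs: "gates_bits hs \<le> (9 * Suc d + 1) * (4 * (Suc d + r) + 4)"
    by simp
  have "gates_bits (adder_tree (Suc d) gss) = gates_bits l + gates_bits r' + gates_bits hs"
    by (simp add: tree)
  then show ?case
    using l r hs unfolding sum by (simp add: algebra_simps power2_eq_square)
qed

section \<open>The majority vote and its cost\<close>

lemma ex_power2_between: "k > 0 \<Longrightarrow> \<exists>D. k \<le> 2 ^ D \<and> 2 ^ D < 2 * (k::nat)"
proof (cases "k = 1")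
  case False
  assume "k > 0"
  with False obtain D where "2 ^ D < k" "k \<le> 2 ^ (D + 1)"
    using ex_power_ivl2[of 2 k] by auto
  then show ?thesis by (intro exI[of _ "D + 1"]) simp
qed (auto intro!: exI[of _ 0])

text \<open>With \<open>P\<close> a power of two, \<open>w\<close> holds the low bits of the padded
  count and \<open>p\<close>, \<open>q\<close> are its two top bits. The count stays below
  \<open>2 * P\<close>, so \<open>q\<close> is off and \<open>p\<close> tests whether
  \<open>m\<close> reaches \<open>k div 2 + 1\<close>.\<close>

lemma threshold_bit:
  fixes w P m a k :: nat
  assumes "w + P * (of_bool p + 2 * of_bool q) = m + a" "w < P" "m \<le> k"
    and "a + (k div 2 + 1) = P" "k \<le> P"
  shows "p \<longleftrightarrow> k < 2 * m"
proof -
  have "\<not> q"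
  proof
    assume q
    then have "2 * P \<le> m + a" using assms(1) by (cases p) auto
    then show False using assms(3-5) by linarith
  qed
  then have "w + (if p then P else 0) = m + a"
    using assms(1) by (cases p) auto
  moreover have "k < 2 * m \<longleftrightarrow> k div 2 + 1 \<le> m"
    by linarith
  ultimately show ?thesis
    using assms(2,4) by (auto split: if_splits)
qed

text \<open>The tree has fewer than \<open>4 * k\<close> leaves for \<open>k\<close> votes. Each
  leaf is charged 3 bits for a possible constant and \<open>76 * (r + 1) + 224\<close> for the
  adders; the output gate takes 8 bits. Four times the charge plus 8 gives the overhead per
  vote.\<close>

lemma majority_circuit:
  assumes cs: "set cs \<subseteq> circuits n" "\<And>c. c \<in> set cs \<Longrightarrow> circuit_size c \<le> s"
    and ne: "cs \<noteq> []" and r: "s + 19 \<le> 2 ^ r"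
  shows "\<exists>c\<in>circuits n. circuit_size c \<le> length cs * (s + 304 * (r + 1) + 916) \<and>
    (\<forall>x. circuit_output c x \<longleftrightarrow> length cs < 2 * length (filter (\<lambda>c. circuit_output c x) cs))"
proof -
  define k where "k = length cs"
  have k: "k > 0" using ne by (simp add: k_def)
  obtain D where D: "k \<le> 2 ^ D" "2 ^ D < 2 * k"
    using ex_power2_between[OF k] by blast
  \<comment> \<open>Padding by constant leaves moves the threshold \<open>k div 2 + 1\<close> to the power \<open>2 ^ D\<close>, so the
    vote is a single bit of the count.\<close>
  define a where "a = 2 ^ D - (k div 2 + 1)"
  define b where "b = 2 ^ Suc D - k - a"
  define gss where "gss = map gates cs @ replicate a [Const_gate True] @ replicate b [Const_gate False]"
  have a: "a + (k div 2 + 1) = 2 ^ D" using D k by (simp add: a_def)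
  have b: "k + a + b = 2 ^ Suc D" using a D unfolding b_def by simp
  have len: "length gss = 2 ^ Suc D" using b by (simp add: gss_def k_def)
  have bits: "gates_bits (gates c) + length (encode_nat n) \<le> s" if "c \<in> set cs" for c
    using cs(1) cs(2)[OF that] that by (auto simp: circuit_size_eq circuits_def)
  have enc: "length (encode_nat n) \<ge> 1" by (subst encode_nat.simps) auto
  have gss: "gs \<noteq> [] \<and> ok_gates n 0 gs \<and> length gs \<le> s" if "gs \<in> set gss" for gs
  proof -
    consider c where "c \<in> set cs" "gs = gates c" | "gs \<in> {[Const_gate True], [Const_gate False]}"
      using \<open>gs \<in> set gss\<close> by (auto simp: gss_def)
    then show ?thesis
    proof cases
      case (1 c)
      then show ?thesis
        using cs bits[of c] length_le_gates_bits[of gs] by (auto simp: circuits_def well_formed_iff)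
    next
      case 2
      moreover obtain c where "c \<in> set cs" using ne by (cases cs) auto
      then have "1 \<le> s" using bits[of c] enc by linarith
      ultimately show ?thesis by auto
    qed
  qed
  define T where "T = adder_tree (Suc D) gss"
  \<comment> \<open>The last gate copies bit \<open>D\<close> of the count, found at address 1, to
    the top as output.\<close>
  define c where "c = Circuit n (T @ [And_gate 1 1])"
  have T: "ok_gates n 0 T" "9 * Suc D < length T"
    "bits_value (map ((!) (run_gates x T [])) (sum_positions (Suc D))) = output_count x gss" for x
    using adder_tree_correct[OF len] gss unfolding T_def by blast+
  have "c \<in> circuits n"
    using T by (simp add: c_def circuits_def well_formed_iff)
  moreover have "circuit_output c x \<longleftrightarrow> k < 2 * length (filter (\<lambda>c. circuit_output c x) cs)" for x
  proof -
    let ?v = "run_gates x T []"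
    obtain ps where ps: "sum_positions (Suc D) = ps @ [1, 0]" "length ps = D"
      using sum_positions_Suc by blast
    let ?w = "bits_value (map ((!) ?v) ps)"
    let ?m = "length (filter (\<lambda>c. circuit_output c x) cs)"
    have "(\<Sum>c\<leftarrow>cs. of_bool (hd (run_gates x (gates c) []))) = ?m"
      by (induction cs) (auto simp: circuit_output_def)
    then have "output_count x gss = ?m + a"
      by (simp add: gss_def output_count_def comp_def sum_list_replicate)
    then have eq: "?w + 2 ^ D * (of_bool (?v ! 1) + 2 * of_bool (?v ! 0)) = ?m + a"
      using T(3)[of x] unfolding ps(1) by (simp add: ps(2) bits_value_append)
    have w: "?w < 2 ^ D" using bits_value_less[of "map ((!) ?v) ps"] ps by simp
    have m: "?m \<le> k" by (simp add: k_def)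
    have out: "circuit_output c x = ?v ! 1"
      by (simp add: c_def circuit_output_def run_gates_append)
    show ?thesis
      unfolding out by (rule threshold_bit[OF eq w m a D(1)])
  qed
  moreover have "circuit_size c \<le> k * (s + 304 * (r + 1) + 916)"
  proof -
    define G where "G = (\<Sum>c\<leftarrow>cs. gates_bits (gates c))"
    define H where "H = (\<Sum>gs\<leftarrow>gss. gates_bits gs)"
    have "G + k * length (encode_nat n) \<le> k * s"
      unfolding G_def k_def using bits
    proof (induction cs)
      case (Cons c cs)
      then show ?case by (fastforce simp: add.assoc)
    qed simp
    \<comment> \<open>The combined circuit pays once for the arity, the voters paid \<open>k\<close>
      times.\<close>
    moreover have "length (encode_nat n) \<le> k * length (encode_nat n)"
      using k by simp
    moreover have "H = G + 3 * (a + b)"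
      by (simp add: G_def H_def gss_def comp_def sum_list_replicate)
    ultimately have "H + length (encode_nat n) \<le> k * s + 3 * (a + b)"
      by linarith
    also have "\<dots> \<le> k * s + 3 * 2 ^ Suc D"
      unfolding b[symmetric] by simp
    finally have 1: "H + length (encode_nat n) \<le> k * s + 3 * 2 ^ Suc D" .
    have "gates_bits T \<le> H + 2 ^ Suc D * (76 * (r + 1) + 224)"
      using adder_tree_bits_le[OF len gss r] unfolding T_def H_def by linarith
    moreover have "circuit_size c = length (encode_nat n) + gates_bits T + 8"
      by (simp add: circuit_size_eq c_def encode_nat.simps)
    ultimately have "circuit_size c \<le> k * s + 2 ^ Suc D * (76 * (r + 1) + 227) + 8"
      using 1 by (simp add: algebra_simps)
    also have "\<dots> \<le> k * s + (4 * k) * (76 * (r + 1) + 227) + 8 * k"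
      using D k by (intro add_mono mult_right_mono) auto
    also have "\<dots> = k * (s + 304 * (r + 1) + 916)"
      by (simp add: algebra_simps)
    finally show ?thesis .
  qed
  ultimately show ?thesis
    unfolding k_def by blast
qed

text \<open>The fraction is chosen so that \<open>22 / 10 * (136 / 100) < 3\<close> closes the final
  size estimate.\<close>

lemma majority_overhead_negligible:
  "\<exists>S. \<forall>s\<ge>S. \<exists>r. s + 19 \<le> 2 ^ r \<and> real (304 * (r + 1) + 916) \<le> 36 / 100 * real s"
proof -
  have "eventually (\<lambda>s. 304 * (log 2 (real s + 19) + 2) + 916 \<le> 36 / 100 * real s) sequentially"
    by real_asymp
  then obtain S where S: "304 * (log 2 (real s + 19) + 2) + 916 \<le> 36 / 100 * real s" if "s \<ge> S" for s
    by (auto simp: eventually_sequentially)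
  have "\<exists>r. s + 19 \<le> 2 ^ r \<and> real (304 * (r + 1) + 916) \<le> 36 / 100 * real s" if "s \<ge> S" for s
  proof -
    define r where "r = nat \<lceil>log 2 (real s + 19)\<rceil>"
    have pos: "log 2 (real s + 19) \<ge> 0" by simp
    have le: "log 2 (real s + 19) \<le> real r" "real r \<le> log 2 (real s + 19) + 1"
      unfolding r_def using pos by linarith+
    have "real s + 19 \<le> 2 powr real r"
      using le(1) by (simp add: log_le_iff)
    then have "real (s + 19) \<le> real (2 ^ r)"
      by (simp add: powr_realpow)
    then have "s + 19 \<le> 2 ^ r"
      by (simp only: of_nat_le_iff)
    moreover have "real (304 * (r + 1) + 916) \<le> 36 / 100 * real s"
      using S[OF that] le(2) by simp
    ultimately show ?thesis by blast
  qed
  then show ?thesis by blast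
qed


subsection \<open>The game between circuits and inputs\<close>

text \<open>Inputs respond to weights on circuits, and a hit is a correct answer. The target
  \<open>1 / 2 + 2 / 5 * \<epsilon>\<close> plus the deviation \<open>3 / 5 * \<epsilon>\<close>
  allows a fraction \<open>1 / 2 + \<epsilon>\<close> of correct answers.\<close>

lemma hard_multiset_of_hard_weights:
  fixes \<epsilon> :: real and n s :: nat
  assumes eps: "0 < \<epsilon>" "\<epsilon> < 1 / 2"
  defines "\<C> \<equiv> {c \<in> circuits n. circuit_size c \<le> s}"
  defines "m \<equiv> nat \<lceil>real s / \<epsilon>\<^sup>2\<rceil>"
  assumes w: "\<And>x. length x = n \<Longrightarrow> w x > (0::real)"
    and hard: "\<And>c. c \<in> \<C> \<Longrightarrow> (\<Sum>x | length x = n. w x * of_bool (misclassifies c L x)) >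
      (1 / 2 - 2 / 5 * \<epsilon>) * (\<Sum>x | length x = n. w x)"
  shows "\<exists>xs. length xs = m \<and> set xs \<subseteq> {x. length x = n} \<and>
    (\<forall>c\<in>\<C>. real (length (filter (misclassifies c L) xs)) \<ge> (1 / 2 - \<epsilon>) * real m)"
proof -
  let ?I = "{x :: bool list. length x = n}"
  let ?v = "1 / 2 + 2 / 5 * \<epsilon>"
  have finI: "finite ?I"
    using finite_lists_length_eq[of "UNIV :: bool set" n] by simp
  have finC: "finite \<C>"
    unfolding \<C>_def by (rule finite_circuits_bounded_size)
  have m: "real m \<ge> real s / \<epsilon>\<^sup>2"
    unfolding m_def by linarith
  have cardC: "real (card \<C>) < exp (2 * real m * (3 / 5 * \<epsilon>)\<^sup>2)"
  proof -
    have "real (card \<C>) < 2 ^ s"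
      using card_circuits_bounded_size[of n s] unfolding \<C>_def
      by (metis of_nat_less_iff of_nat_numeral of_nat_power)
    also have "\<dots> = exp (real s * ln 2)"
      by (simp add: exp_of_nat_mult)
    \<comment> \<open>Here \<open>18 / 25 = 2 * (3 / 5)\<^sup>2\<close>, which exceeds
      \<open>25 / 36\<close>.\<close>
    also have "real s * ln 2 \<le> real s * (18 / 25)"
      using ln2_le_25_over_36 by (intro mult_left_mono) auto
    also have "\<dots> = 2 * (real s / \<epsilon>\<^sup>2) * (3 / 5 * \<epsilon>)\<^sup>2"
      using eps by (simp add: field_simps power2_eq_square)
    also have "\<dots> \<le> 2 * real m * (3 / 5 * \<epsilon>)\<^sup>2"
      using m by (intro mult_right_mono) auto
    finally show ?thesis by simp
  qed
  have "\<exists>x\<in>?I. (\<Sum>c\<in>\<C>. u c * of_bool (\<not> misclassifies c L x)) \<le> ?v * (\<Sum>c\<in>\<C>. u c)"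
    if u: "\<And>c. c \<in> \<C> \<Longrightarrow> u c > 0" for u :: "circuit \<Rightarrow> real"
  proof (rule ccontr)
    assume "\<not> ?thesis"
    then have less: "?v * (\<Sum>c\<in>\<C>. u c) < (\<Sum>c\<in>\<C>. u c * of_bool (\<not> misclassifies c L x))"
      if "length x = n" for x
      using that by (auto simp: not_le)
    \<comment> \<open>If every input failed, averaging over \<open>w\<close> and exchanging the sums
      would contradict \<open>hard\<close>. Strictness comes from positive \<open>w\<close> and
      nonempty \<open>?I\<close>.\<close>
    have "(\<Sum>x\<in>?I. w x * (?v * (\<Sum>c\<in>\<C>. u c))) <
        (\<Sum>x\<in>?I. w x * (\<Sum>c\<in>\<C>. u c * of_bool (\<not> misclassifies c L x)))"
    proof (rule sum_strict_mono[OF finI])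
      show "?I \<noteq> {}" by (auto intro: exI[of _ "replicate n False"])
    qed (use w less in simp)
    also have "\<dots> = (\<Sum>c\<in>\<C>. u c * (\<Sum>x\<in>?I. w x * of_bool (\<not> misclassifies c L x)))"
      unfolding sum_distrib_left by (subst sum.swap) (simp add: mult.left_commute)
    also have "\<dots> \<le> (\<Sum>c\<in>\<C>. u c * (?v * (\<Sum>x\<in>?I. w x)))"
    proof (intro sum_mono mult_left_mono)
      fix c assume c: "c \<in> \<C>"
      have "(\<Sum>x\<in>?I. w x * of_bool (\<not> misclassifies c L x)) =
          (\<Sum>x\<in>?I. w x) - (\<Sum>x\<in>?I. w x * of_bool (misclassifies c L x))"
        unfolding sum_subtractf[symmetric] by (intro sum.cong) auto
      also have "\<dots> \<le> ?v * (\<Sum>x\<in>?I. w x)"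
        using hard[OF c] by (simp add: algebra_simps)
      finally show "(\<Sum>x\<in>?I. w x * of_bool (\<not> misclassifies c L x)) \<le> ?v * (\<Sum>x\<in>?I. w x)" .
      show "0 \<le> u c" using u[OF c] by simp
    qed
    also have "\<dots> = (\<Sum>x\<in>?I. w x * (?v * (\<Sum>c\<in>\<C>. u c)))"
      by (simp add: sum_distrib_right[symmetric] mult_ac)
    finally show False by simp
  qed
  then obtain xs where xs: "length xs = m" "set xs \<subseteq> ?I"
    "\<And>c. c \<in> \<C> \<Longrightarrow> real (length (filter (\<lambda>x. \<not> misclassifies c L x) xs)) < real m * (?v + 3 / 5 * \<epsilon>)"
    using multiplicative_weights[of \<C> ?v "3 / 5 * \<epsilon>" ?I "\<lambda>x c. \<not> misclassifies c L x" m]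
      finC cardC eps by auto
  have "real (length (filter (misclassifies c L) xs)) \<ge> (1 / 2 - \<epsilon>) * real m" if "c \<in> \<C>" for c
    using xs(3)[OF that] sum_length_filter_compl[of "misclassifies c L" xs] xs(1)
    by (simp add: algebra_simps)
  with xs show ?thesis by blast
qed

text \<open>Now circuits respond to weights on inputs and a hit is an error. Target and deviation
  add up to exactly \<open>1 / 2\<close>, so the majority of the responses decides \<open>L\<close>
  at length \<open>n\<close>.\<close>

lemma circuit_complexity_less:
  fixes \<epsilon> :: real
  assumes eps: "0 < \<epsilon>" "\<epsilon> < 1 / 2" and s: "s > 0" and n: "n \<ge> 50"
    and r: "s + 19 \<le> 2 ^ r" "real (304 * (r + 1) + 916) \<le> 36 / 100 * real s"
  assumes easy: "\<And>w. (\<And>x. length x = n \<Longrightarrow> w x > (0::real)) \<Longrightarrow>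
      \<exists>c\<in>{c \<in> circuits n. circuit_size c \<le> s}.
        (\<Sum>x | length x = n. w x * of_bool (misclassifies c L x)) \<le>
        (1 / 2 - 2 / 5 * \<epsilon>) * (\<Sum>x | length x = n. w x)"
  shows "real (circuit_complexity L n) * \<epsilon>\<^sup>2 < 3 * real n * real s"
proof -
  let ?I = "{x :: bool list. length x = n}"
  let ?C = "{c \<in> circuits n. circuit_size c \<le> s}"
  let ?v = "1 / 2 - 2 / 5 * \<epsilon>"
  \<comment> \<open>The factor satisfies \<open>2 * (218 / 100) * (2 / 5)\<^sup>2 > 25 / 36\<close>,
    an upper bound of \<open>ln 2\<close>.\<close>
  define k where "k = nat \<lceil>218 / 100 * real n / \<epsilon>\<^sup>2\<rceil>"
  have eps2: "0 < \<epsilon>\<^sup>2" "\<epsilon>\<^sup>2 \<le> 1"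
    using eps by (auto simp: abs_square_le_1)
  have k_ge: "218 / 100 * real n / \<epsilon>\<^sup>2 \<le> real k"
    unfolding k_def by linarith
  have "218 / 100 * real n / \<epsilon>\<^sup>2 \<ge> 0" by simp
  then have k_le: "real k \<le> 218 / 100 * real n / \<epsilon>\<^sup>2 + 1"
    unfolding k_def by linarith
  have k_pos: "k > 0"
    using n eps2 by (auto simp: k_def)
  have finI: "finite ?I" and cardI: "card ?I = 2 ^ n"
    using finite_lists_length_eq[of "UNIV :: bool set" n] card_lists_length_eq[of "UNIV :: bool set" n]
    by simp_all
  have "real (card ?I) < exp (2 * real k * (2 / 5 * \<epsilon>)\<^sup>2)"
  proof -
    have "real (card ?I) = exp (real n * ln 2)"
      by (simp add: cardI exp_of_nat_mult)
    also have "real n * ln 2 \<le> real n * (25 / 36)"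
      using ln2_le_25_over_36 by (intro mult_left_mono) auto
    also have "\<dots> < 2 * (218 / 100 * real n / \<epsilon>\<^sup>2) * (2 / 5 * \<epsilon>)\<^sup>2"
      using eps n by (simp add: field_simps power2_eq_square)
    also have "\<dots> \<le> 2 * real k * (2 / 5 * \<epsilon>)\<^sup>2"
      using k_ge by (intro mult_right_mono) auto
    finally show ?thesis by simp
  qed
  then obtain cs where cs: "length cs = k" "set cs \<subseteq> ?C"
    "\<And>x. length x = n \<Longrightarrow> real (length (filter (\<lambda>c. misclassifies c L x) cs)) < real k * (?v + 2 / 5 * \<epsilon>)"
    using multiplicative_weights[of ?I ?v "2 / 5 * \<epsilon>" ?C "\<lambda>c. misclassifies c L" k] finI eps easy
    by auto
  obtain c where c: "c \<in> circuits n" "circuit_size c \<le> k * (s + 304 * (r + 1) + 916)"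
    "\<And>x. circuit_output c x \<longleftrightarrow> k < 2 * length (filter (\<lambda>c. circuit_output c x) cs)"
    using majority_circuit[of cs n s r] cs k_pos r(1) by auto
  have "decides c L n"
    unfolding decides_def
  proof (intro allI impI)
    fix x :: "bool list" assume x: "length x = n"
    \<comment> \<open>Strictness excludes ties, which the majority circuit would reject even for
      \<open>x\<close> in \<open>L\<close>.\<close>
    have less: "2 * length (filter (\<lambda>c. misclassifies c L x) cs) < k"
      using cs(3)[OF x] by simp
    show "\<not> misclassifies c L x"
    proof (cases "x \<in> L")
      case True
      then have "length (filter (\<lambda>c. misclassifies c L x) cs) +
          length (filter (\<lambda>c. circuit_output c x) cs) = k"
        using sum_length_filter_compl[of "\<lambda>c. misclassifies c L x" cs] cs(1)
        by (simp add: misclassifies_def)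
      with less True show ?thesis by (simp add: misclassifies_def c(3))
    next
      case False
      with less show ?thesis by (simp add: misclassifies_def c(3))
    qed
  qed
  with c(1) have "circuit_complexity L n \<le> circuit_size c"
    unfolding circuit_complexity_def by (intro Least_le) auto
  with c(2) have "circuit_complexity L n \<le> k * (s + 304 * (r + 1) + 916)"
    by (rule order_trans[rotated])
  then have "real (circuit_complexity L n) \<le> real (k * (s + 304 * (r + 1) + 916))"
    by (simp only: of_nat_le_iff)
  also have "\<dots> = real k * (real s + real (304 * (r + 1) + 916))"
    by (simp only: of_nat_mult of_nat_add) simp
  also have "\<dots> \<le> real k * (136 / 100 * real s)"
    using r(2) by (intro mult_left_mono) auto
  finally have "real (circuit_complexity L n) * \<epsilon>\<^sup>2 \<le> (real k * (136 / 100 * real s)) * \<epsilon>\<^sup>2"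
    by (rule mult_right_mono) simp
  also have "\<dots> = (real k * \<epsilon>\<^sup>2) * (136 / 100 * real s)"
    by (simp add: mult_ac)
  also have "\<dots> \<le> (22 / 10 * real n) * (136 / 100 * real s)"
  proof (intro mult_right_mono)
    have "real k * \<epsilon>\<^sup>2 \<le> (218 / 100 * real n / \<epsilon>\<^sup>2 + 1) * \<epsilon>\<^sup>2"
      using k_le by (intro mult_right_mono) auto
    also have "\<dots> = 218 / 100 * real n + \<epsilon>\<^sup>2"
      using eps by (simp add: field_simps)
    \<comment> \<open>Rounding \<open>k\<close> up costs at most \<open>\<epsilon>\<^sup>2\<close>,
      hence at most 1, which \<open>n \<ge> 50\<close> absorbs.\<close>
    also have "\<dots> \<le> 22 / 10 * real n"
      using eps2 n by linarith
    finally show "real k * \<epsilon>\<^sup>2 \<le> 22 / 10 * real n" .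
  qed simp
  also have "\<dots> < 3 * real n * real s"
    using n s by simp
  finally show ?thesis .
qed

theorem theorem4:
  "\<exists>N::nat. \<forall>(L :: bool list set) (n::nat) (\<epsilon>::real) (s::nat).
     n > N \<longrightarrow> \<epsilon> > 0 \<longrightarrow>
     real s \<le> real (circuit_complexity L n) * \<epsilon>\<^sup>2 / (3 * real n) \<longrightarrow>
     (\<exists>X :: bool list multiset.
        size X = nat \<lceil>real s / \<epsilon>\<^sup>2\<rceil> \<and>
        (\<forall>x \<in># X. length x = n) \<and>
        (\<forall>c \<in> circuits n. circuit_size c \<le> s \<longrightarrow>
           real (size {#x \<in># X. misclassifies c L x#}) / real (size X) \<ge> 1 / 2 - \<epsilon>))"
proof -
  obtain S where S: "\<And>s. s \<ge> S \<Longrightarrow>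
      \<exists>r. s + 19 \<le> 2 ^ r \<and> real (304 * (r + 1) + 916) \<le> 36 / 100 * real s"
    using majority_overhead_negligible by blast
  show ?thesis
  \<comment> \<open>The summand \<open>2 ^ S\<close> makes the arity code longer than
    \<open>S\<close>, so any circuit of size at most \<open>s\<close> forces \<open>s > S\<close>,
    whatever \<epsilon> is. The 50 pays for rounding \<open>k\<close>.\<close>
  proof (rule exI[of _ "2 ^ S + 50"], intro allI impI)
    fix L :: "bool list set" and n s :: nat and \<epsilon> :: real
    assume n: "n > 2 ^ S + 50" and eps: "\<epsilon> > 0"
      and le: "real s \<le> real (circuit_complexity L n) * \<epsilon>\<^sup>2 / (3 * real n)"
    define m where "m = nat \<lceil>real s / \<epsilon>\<^sup>2\<rceil>"
    let ?C = "{c \<in> circuits n. circuit_size c \<le> s}"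
    have "\<exists>X. size X = m \<and> (\<forall>x \<in># X. length x = n) \<and>
        (\<forall>c \<in> circuits n. circuit_size c \<le> s \<longrightarrow>
           real (size {#x \<in># X. misclassifies c L x#}) / real (size X) \<ge> 1 / 2 - \<epsilon>)"
    proof (cases "\<epsilon> \<ge> 1 / 2 \<or> ?C = {}")
      case True
      \<comment> \<open>Any multiset of the right size works here, even for \<open>m = 0\<close>,
        where the quotient is 0 by convention.\<close>
      have "1 / 2 - \<epsilon> \<le> real a / real b" if "c \<in> ?C" for c and a b :: nat
      proof -
        have "1 / 2 - \<epsilon> \<le> 0" using True that by auto
        also have "0 \<le> real a / real b" by simp
        finally show ?thesis .
      qed
      then show ?thesis
        by (intro exI[of _ "replicate_mset m (replicate n False)"]) (simp split: if_splits)
    next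
      case False
      then have eps': "\<epsilon> < 1 / 2" by simp
      from False obtain c where c: "c \<in> circuits n" "circuit_size c \<le> s" by blast
      have "S < length (encode_nat n)"
        using n by (intro length_encode_nat_ge) simp
      with c have "S < s" by (auto simp: circuit_size_eq circuits_def)
      then obtain r where r: "s + 19 \<le> 2 ^ r" "real (304 * (r + 1) + 916) \<le> 36 / 100 * real s"
        using S[of s] by auto
      have s: "s > 0" and n50: "n \<ge> 50" using \<open>S < s\<close> n by auto
      have m: "m > 0" using s eps by (simp add: m_def)
      \<comment> \<open>The size hypothesis refutes the conclusion of
        \<open>circuit_complexity_less\<close>, so its premise \<open>easy\<close> fails and some
        \<open>w\<close> is hard for all circuits.\<close>
      have "\<not> real (circuit_complexity L n) * \<epsilon>\<^sup>2 < 3 * real n * real s"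
        using le n50 by (simp add: field_simps)
      then obtain w where w: "\<And>x. length x = n \<Longrightarrow> w x > (0::real)"
        "\<And>c. c \<in> ?C \<Longrightarrow> (\<Sum>x | length x = n. w x * of_bool (misclassifies c L x)) >
          (1 / 2 - 2 / 5 * \<epsilon>) * (\<Sum>x | length x = n. w x)"
        using circuit_complexity_less[OF eps eps' s n50 r, of L] by (meson not_le)
      obtain xs where xs: "length xs = m" "set xs \<subseteq> {x. length x = n}"
        "\<And>c. c \<in> ?C \<Longrightarrow> real (length (filter (misclassifies c L) xs)) \<ge> (1 / 2 - \<epsilon>) * real m"
        using hard_multiset_of_hard_weights[OF eps eps' w] unfolding m_def by blast
      show ?thesis
      proof (intro exI[of _ "mset xs"] conjI ballI impI)
        fix c assume "c \<in> circuits n" "circuit_size c \<le> s"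
        then show "1 / 2 - \<epsilon> \<le> real (size {#x \<in># mset xs. misclassifies c L x#}) / real (size (mset xs))"
          using xs(1) xs(3)[of c] m by (simp add: pos_le_divide_eq flip: mset_filter)
      qed (use xs in auto)
    qed
    then show "\<exists>X :: bool list multiset. size X = nat \<lceil>real s / \<epsilon>\<^sup>2\<rceil> \<and>
        (\<forall>x \<in># X. length x = n) \<and>
        (\<forall>c \<in> circuits n. circuit_size c \<le> s \<longrightarrow>
           real (size {#x \<in># X. misclassifies c L x#}) / real (size X) \<ge> 1 / 2 - \<epsilon>)"
      unfolding m_def .
  qed
qed

end
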